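(* Let $n$ and $r$ be positive integers. For a non-negative integer $a$ and a positive integer $b$, let $P(a,b)$ denote the number of lattice paths in the plane using unit steps $(1,0)$ and $(0,1)$ from $(0,0)$ to $(a+b,\,a+b-1)$ that never touch any point of the set $\{(x,x)\in\mathbb{Z}^2 : x\ge b\}$. Then \[ P(n-1,r+1)-P(n,r)=\binom{2r}{r}\,C_{n-1}, \] where $C_m=\frac{1}{m+1}\binom{2m}{m}$ is the $m$th Catalan number.
   Context: $P(a,b)$ is called the Gessel number. $C_m=\frac{1}{m+1}\binom{2m}{m}$ denotes the $m$th Catalan number. *)

theory Defs
  imports Complex_Main "HOL-Library.Product_Plus"
begin

definition lattice_step :: "int \<times> int \<Rightarrow> int \<times> int \<Rightarrow> bool" where
  "lattice_step p q \<longleftrightarrow> q = p + (1, 0) \<or> q = p + (0, 1)"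

text \<open>A path is the list of all lattice points it visits, including both endpoints.\<close>

definition lattice_paths :: "int \<times> int \<Rightarrow> int \<times> int \<Rightarrow> (int \<times> int) list set" where
  "lattice_paths p q = {w. w \<noteq> [] \<and> hd w = p \<and> last w = q \<and> successively lattice_step w}"

definition gessel :: "nat \<Rightarrow> nat \<Rightarrow> nat" where
  "gessel a b = card {w \<in> lattice_paths (0, 0) (int a + int b, int a + int b - 1).
     set w \<inter> {(x, x) | x. x \<ge> int b} = {}}"

definition catalan :: "nat \<Rightarrow> rat" where
  "catalan m = 1 / of_nat (m + 1) * of_nat ((2 * m) choose m)"

end

theory Submission
  imports Defs
begin

text \<open>
  Both Gessel numbers count paths from the origin to \<open>(n + r, n + r - 1)\<close>, and the path counts
  for varying end points obey Pascal's recurrence off the forbidden diagonal. The two forbidden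
  sets differ only in \<open>(r, r)\<close>, so the difference of the two counts, as a function of the end
  point, starts with value \<open>(2 * r) choose r\<close> at \<open>(r, r)\<close> and continues below the diagonal by the
  ballot recurrence.
\<close>

definition avoiding_paths ::
    "(int \<times> int) set \<Rightarrow> int \<times> int \<Rightarrow> int \<times> int \<Rightarrow> (int \<times> int) list set" where
  "avoiding_paths D p q = {w \<in> lattice_paths p q. set w \<inter> D = {}}"

text \<open>Paths are analysed by their last step, so that the start stays fixed while the end point
  varies; \<open>w \<noteq> []\<close> sets aside the one-point path.\<close>

lemma lattice_path_append:
  assumes "w \<noteq> []"
  shows "w @ [x] \<in> lattice_paths p q \<longleftrightarrow>
    x = q \<and> (w \<in> lattice_paths p (q - (1, 0)) \<or> w \<in> lattice_paths p (q - (0, 1)))"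
  using assms
  by (auto simp: lattice_paths_def successively_append_iff lattice_step_def eq_diff_eq)

lemma lattice_path_le:
  assumes "w \<in> lattice_paths p q"
  shows "fst p \<le> fst q \<and> snd p \<le> snd q"
  using assms
proof (induction w arbitrary: q rule: rev_induct)
  case Nil
  then show ?case by (simp add: lattice_paths_def)
next
  case (snoc x w)
  show ?case
  proof (cases "w = []")
    case True
    with snoc.prems show ?thesis by (auto simp: lattice_paths_def)
  next
    case False
    with snoc.prems have "w \<in> lattice_paths p (q - (1, 0)) \<or> w \<in> lattice_paths p (q - (0, 1))"
      by (simp add: lattice_path_append)
    then show ?thesis by (auto dest!: snoc.IH)
  qed
qed

lemma avoiding_paths_empty:
  "fst q < fst p \<or> snd q < snd p \<Longrightarrow> avoiding_paths D p q = {}"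
  by (auto simp: avoiding_paths_def dest!: lattice_path_le)

lemma avoiding_paths_forbidden: "q \<in> D \<Longrightarrow> avoiding_paths D p q = {}"
  using last_in_set by (fastforce simp: avoiding_paths_def lattice_paths_def)

lemma avoiding_paths_refl:
  assumes "p \<notin> D"
  shows "avoiding_paths D p p = {[p]}"
proof -
  have "w \<in> {[p]}" if w: "w \<in> lattice_paths p p" for w
  proof (cases w rule: rev_cases)
    case Nil
    with w show ?thesis by (simp add: lattice_paths_def)
  next
    case (snoc v x)
    have "v = []"
    proof (rule ccontr)
      assume "v \<noteq> []"
      with w snoc have "v \<in> lattice_paths p (p - (1, 0)) \<or> v \<in> lattice_paths p (p - (0, 1))"
        by (simp add: lattice_path_append)
      then show False
        using lattice_path_le[of v p "p - (1, 0)"] lattice_path_le[of v p "p - (0, 1)"] by auto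
    qed
    with w snoc show ?thesis by (simp add: lattice_paths_def)
  qed
  moreover have "[p] \<in> lattice_paths p p" by (simp add: lattice_paths_def)
  ultimately have single: "lattice_paths p p = {[p]}" by blast
  show ?thesis unfolding avoiding_paths_def single using assms by auto
qed

lemma avoiding_paths_step:
  assumes "p \<noteq> q" "q \<notin> D"
  shows "avoiding_paths D p q =
    (\<lambda>w. w @ [q]) ` (avoiding_paths D p (q - (1, 0)) \<union> avoiding_paths D p (q - (0, 1)))"
proof (intro equalityI subsetI)
  fix w assume w: "w \<in> avoiding_paths D p q"
  obtain v x where v: "w = v @ [x]"
    using w by (cases w rule: rev_cases) (auto simp: avoiding_paths_def lattice_paths_def)
  have "v \<noteq> []"
    using w v assms by (auto simp: avoiding_paths_def lattice_paths_def)
  with w v show "w \<in> (\<lambda>w. w @ [q]) `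
      (avoiding_paths D p (q - (1, 0)) \<union> avoiding_paths D p (q - (0, 1)))"
    by (auto simp: avoiding_paths_def lattice_path_append)
next
  fix w assume "w \<in> (\<lambda>w. w @ [q]) `
      (avoiding_paths D p (q - (1, 0)) \<union> avoiding_paths D p (q - (0, 1)))"
  then obtain v where v: "w = v @ [q]"
      "v \<in> avoiding_paths D p (q - (1, 0)) \<union> avoiding_paths D p (q - (0, 1))"
    by blast
  then have "v \<noteq> []" by (auto simp: avoiding_paths_def lattice_paths_def)
  with v assms show "w \<in> avoiding_paths D p q"
    by (auto simp: avoiding_paths_def lattice_path_append)
qed

lemma finite_avoiding_paths: "finite (avoiding_paths D p q)"
\<comment> \<open>The measure is the number of steps from \<open>p\<close> to \<open>q\<close>. It
  is positive in the third case, so the truncation by \<open>nat\<close> does no harm there.\<close>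
proof (induction "nat (fst q + snd q - fst p - snd p)" arbitrary: q rule: less_induct)
  case less
  consider "q \<in> D \<or> fst q < fst p \<or> snd q < snd p" | "q = p" "q \<notin> D"
    | "q \<noteq> p" "q \<notin> D" "fst p \<le> fst q" "snd p \<le> snd q" by linarith
  then show ?case
  proof cases
    case 1
    then show ?thesis by (auto simp: avoiding_paths_empty avoiding_paths_forbidden)
  next
    case 2
    then show ?thesis by (simp add: avoiding_paths_refl)
  next
    case 3
    then have "fst q + snd q - fst p - snd p > 0" by (auto simp: prod_eq_iff)
    then have "finite (avoiding_paths D p (q - (1, 0)))"
        "finite (avoiding_paths D p (q - (0, 1)))"
      by (auto intro!: less)
    with 3 show ?thesis using avoiding_paths_step[of p q D] by simp
  qed
qed

text \<open>Pascal's recurrence: the two families of shortened paths are disjoint because their last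
  points differ.\<close>

lemma card_avoiding_paths_step:
  assumes "p \<noteq> q" "q \<notin> D"
  shows "card (avoiding_paths D p q) =
    card (avoiding_paths D p (q - (1, 0))) + card (avoiding_paths D p (q - (0, 1)))"
proof -
  have "avoiding_paths D p (q - (1, 0)) \<inter> avoiding_paths D p (q - (0, 1)) = {}"
    by (auto simp: avoiding_paths_def lattice_paths_def)
  then show ?thesis
    by (simp add: avoiding_paths_step[OF assms] card_image inj_on_def card_Un_disjoint
        finite_avoiding_paths)
qed

definition diagonal_count :: "nat \<Rightarrow> nat \<Rightarrow> nat \<Rightarrow> nat" where
  "diagonal_count b i j =
    card (avoiding_paths {(x, x) | x. x \<ge> int b} (0, 0) (int i, int j))"

lemma gessel_eq_diagonal_count: "gessel (Suc m) b = diagonal_count b (b + Suc m) (b + m)"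
  by (simp add: gessel_def diagonal_count_def avoiding_paths_def add_ac)

text \<open>On the axes one of the two predecessors lies outside the quadrant and contributes
  nothing. With \<open>b \<ge> 1\<close> the origin is not forbidden.\<close>

lemma diagonal_count_simps:
  assumes "b \<ge> 1"
  shows "diagonal_count b 0 0 = 1"
    and "diagonal_count b (Suc i) 0 = diagonal_count b i 0"
    and "diagonal_count b 0 (Suc j) = diagonal_count b 0 j"
    and "diagonal_count b (Suc i) (Suc j) = (if i = j \<and> b \<le> Suc i then 0
      else diagonal_count b i (Suc j) + diagonal_count b (Suc i) j)"
proof -
  let ?D = "{(x, x) | x. x \<ge> int b}"
  show "diagonal_count b 0 0 = 1"
    using assms by (simp add: diagonal_count_def avoiding_paths_refl)
  show "diagonal_count b (Suc i) 0 = diagonal_count b i 0"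
    using card_avoiding_paths_step[of "(0, 0)" "(int (Suc i), 0)" ?D]
    by (simp add: diagonal_count_def avoiding_paths_empty)
  show "diagonal_count b 0 (Suc j) = diagonal_count b 0 j"
    using card_avoiding_paths_step[of "(0, 0)" "(0, int (Suc j))" ?D]
    by (simp add: diagonal_count_def avoiding_paths_empty)
  show "diagonal_count b (Suc i) (Suc j) = (if i = j \<and> b \<le> Suc i then 0
      else diagonal_count b i (Suc j) + diagonal_count b (Suc i) j)"
    using card_avoiding_paths_step[of "(0, 0)" "(int (Suc i), int (Suc j))" ?D]
      avoiding_paths_forbidden[of "(int (Suc i), int (Suc j))" ?D "(0, 0)"]
    by (auto simp: diagonal_count_def)
qed

text \<open>Coordinates never decrease along a path, so a path to a point with a coordinate below
  \<open>b\<close> cannot meet the forbidden diagonal, and every path counts.\<close>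

lemma diagonal_count_eq_binomial:
  assumes "b \<ge> 1" "i < b \<or> j < b"
  shows "diagonal_count b i j = (i + j) choose i"
  using assms(2)
proof (induction i arbitrary: j)
  case 0
  show ?case by (induction j) (simp_all add: diagonal_count_simps[OF assms(1)])
next
  case (Suc i)
  note outer = Suc.IH
  from Suc.prems show ?case
  proof (induction j)
    case 0
    then show ?case using outer[of 0] assms(1) by (simp add: diagonal_count_simps)
  next
    case (Suc j)
    then show ?case using Suc.IH Suc.prems outer[of "Suc j"] assms(1)
      by (auto simp: diagonal_count_simps)
  qed
qed

text \<open>The second factor is the ballot number in its reflection form: it obeys Pascal's rule,
  equals 1 for \<open>j = 0\<close> and vanishes for \<open>j = Suc i\<close>. These are the
  boundary values of the difference, up to the factor from the corner \<open>(r, r)\<close>.\<close>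

lemma diagonal_count_diff:
  assumes "r \<ge> 1" "j \<le> Suc i"
  shows "int (diagonal_count (Suc r) (r + Suc i) (r + j)) - int (diagonal_count r (r + Suc i) (r + j))
    = int ((2 * r) choose r) * (int ((i + j) choose j) - int ((i + j) choose Suc i))"
proof -
  define h where "h x y = int (diagonal_count (Suc r) x y) - int (diagonal_count r x y)" for x y
  have step: "h (Suc x) (Suc y) = h x (Suc y) + h (Suc x) y" if "x \<noteq> y" for x y
    using that assms(1) by (simp add: h_def diagonal_count_simps)
  have diag: "h (Suc x) (Suc x) = 0" if "r \<le> x" for x
    using that assms(1) by (simp add: h_def diagonal_count_simps)
  have below: "h x y = 0" if "y < r" for x y
    using that assms(1) by (simp add: h_def diagonal_count_eq_binomial)
  obtain s where s: "r = Suc s" using assms(1) by (cases r) auto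
  \<comment> \<open>The row below, at height \<open>s = r - 1\<close>, contributes zero by
    \<open>below\<close>.\<close>
  have row: "h (Suc (r + i)) r = h (r + i) r" for i
    using step[of "r + i" s] below[of s] s by simp
  \<comment> \<open>Only the smaller \<open>b\<close> forbids \<open>(r, r)\<close>, so the other
    count survives whole.\<close>
  have corner: "h r r = int ((2 * r) choose r)"
    using assms(1) s by (simp add: h_def diagonal_count_eq_binomial diagonal_count_simps mult_2)
  have "h (r + Suc i) (r + j)
      = int ((2 * r) choose r) * (int ((i + j) choose j) - int ((i + j) choose Suc i))"
    using assms(2)
  proof (induction i arbitrary: j)
    case 0
    then consider "j = 0" | "j = 1" by linarith
    then show ?case using row[of 0] corner diag[of r] by cases simp_all
  next
    case (Suc i)
    note outer = Suc.IH
    from Suc.prems show ?case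
    proof (induction j)
      case 0
      then show ?case using outer[of 0] row[of "Suc i"] by simp
    next
      case (Suc j)
      show ?case
      proof (cases "j = Suc i")
        \<comment> \<open>The end point lies on the diagonal, forbidden for both counts, and the two
          binomials on the right coincide.\<close>
        case True
        then show ?thesis using diag[of "r + Suc i"] by simp
      next
        case False
        then have "h (r + Suc (Suc i)) (r + Suc j) 
            = h (r + Suc i) (r + Suc j) + h (r + Suc (Suc i)) (r + j)"
          using step[of "r + Suc i" "r + j"] by simp
        then show ?thesis
          using False Suc.IH Suc.prems outer[of "Suc j"] by (simp add: algebra_simps)
      qed
    qed
  qed
  then show ?thesis by (simp add: h_def)
qed

lemma catalan_eq_diff:
  "catalan m = of_nat ((2 * m) choose m) - of_nat ((2 * m) choose Suc m)"
proof -
  \<comment> \<open>Both sides equal \<open>2 * m * ((2 * m - 1) choose m)\<close> by the absorption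
    identities.\<close>
  have "Suc m * ((2 * m) choose Suc m) = m * ((2 * m) choose m)"
    using binomial_absorb_comp[of "2 * m" m] binomial_absorption[of m "2 * m"]
    by (simp add: mult_2)
  then have "rat_of_nat (Suc m * ((2 * m) choose Suc m)) = rat_of_nat (m * ((2 * m) choose m))"
    by (rule arg_cong)
  moreover have "of_nat m + 1 \<noteq> (0 :: rat)"
    using of_nat_neq_0[of m, where ?'a = rat] by (simp add: add.commute)
  ultimately show ?thesis
    unfolding catalan_def by (simp add: divide_simps algebra_simps del: binomial_Suc_Suc)
qed

theorem theorem2:
  fixes n r :: nat
  assumes "n \<ge> 1" and "r \<ge> 1"
  shows "rat_of_nat (gessel (n - 1) (r + 1)) - rat_of_nat (gessel n r)
    = rat_of_nat ((2 * r) choose r) * catalan (n - 1)"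
proof -
  obtain m where n: "n = Suc m" using assms(1) by (cases n) auto
  \<comment> \<open>Here \<open>m\<close> may be 0, which \<open>gessel_eq_diagonal_count\<close>
    does not cover; the end point is the same as that of \<open>gessel n r\<close>.\<close>
  have "gessel m (r + 1) = diagonal_count (Suc r) (r + Suc m) (r + m)"
    by (simp add: gessel_def diagonal_count_def avoiding_paths_def add_ac)
  moreover have "gessel n r = diagonal_count r (r + Suc m) (r + m)"
    unfolding n by (rule gessel_eq_diagonal_count)
  ultimately have "int (gessel m (r + 1)) - int (gessel n r)
      = int ((2 * r) choose r) * (int ((2 * m) choose m) - int ((2 * m) choose Suc m))"
    \<comment> \<open>The case \<open>i = j = m\<close> is the point one step below the diagonal,
      where the ballot number is Catalan.\<close>
    using diagonal_count_diff[OF assms(2), of m m] by (simp add: mult_2)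
  then have "rat_of_int (int (gessel m (r + 1)) - int (gessel n r))
      = rat_of_int (int ((2 * r) choose r) * (int ((2 * m) choose m) - int ((2 * m) choose Suc m)))"
    by (rule arg_cong)
  then show ?thesis by (simp add: n catalan_eq_diff)
qed

end
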